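(* Let $\mathcal V$ be a normed $\mathcal R$-module and let $\mathsf N$ be a local vector measure defined on $\mathcal V$. Then $\mathsf N$ has bounded variation, i.e. $|\mathsf N|(X)<\infty$. More precisely, $$|\mathsf N|(A)=\|\mathsf N(A)\|'\qquad\text{for every Borel set }A\subseteq X.$$
   Context: $(X,\tau)$ is a Polish space, $\mathcal B(X)$ its Borel $\sigma$-algebra, $C_b(X)$ the ring of bounded continuous real functions on $X$ with the sup norm $\|\cdot\|_\infty$. A subring $\mathcal R\subseteq C_b(X)$ (containing the unity) approximates open sets if it is a lattice, is closed under multiplication by constants, and for every open $A\subseteq X$ there is a sequence $\{f_k\}_k\subseteq\mathcal R$ with $f_k(x)\nearrow\chi_A(x)$ for every $x\in X$. A normed $\mathcal R$-module (where $\mathcal R$ is always assumed to approximate open sets) is a normed real vector space $(\mathcal V,\|\cdot\|)$ that is also a module over the ring $\mathcal R$ in the algebraic sense and satisfies $\|f_1v_1+\dots+f_nv_n\|\le\max_i\|f_i\|_\infty\max_i\|v_i\|$ whenever $v_1,\dots,v_n\in\mathcal V$ and $f_1,\dots,f_n\in\mathcal R$ have pairwise disjoint supports. For $A\subseteq X$ open and $v\in\mathcal V$ set $\|v\|_{|A}:=\sup\{\|fv\|:f\in\mathcal R,\ \operatorname{supp}f\subseteq A,\ \|f\|_\infty\le1\}$. $(\mathcal V',\|\cdot\|')$ is the dual normed space of $\mathcal V$. A $\mathcal V'$-valued measure is a map $\mathsf N:\mathcal B(X)\to\mathcal V'$ that is $\sigma$-additive, with convergence of the series in the norm of $\mathcal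 V'$. A local vector measure defined on $\mathcal V$ is a $\mathcal V'$-valued measure that is weakly local: $\mathsf N(A)(v)=0$ for every $A\subseteq X$ open and $v\in\mathcal V$ with $\|v\|_{|A}=0$. The total variation of $\mathsf N$ is the (extended real valued) Borel measure $|\mathsf N|(E):=\sup_\pi\sum_{A\in\pi}\|\mathsf N(A)\|'$, the supremum being over all finite Borel partitions $\pi$ of the Borel set $E$. *)

theory Defs
  imports "HOL-Analysis.Analysis"
begin

unbundle bcontfun.lifting

instantiation bcontfun :: (topological_space, real_normed_field) comm_ring_1
begin

lift_definition one_bcontfun :: "'a \<Rightarrow>\<^sub>C 'b" is "\<lambda>_. 1"
  by (rule const_bcontfun)

lift_definition times_bcontfun :: "('a \<Rightarrow>\<^sub>C 'b) \<Rightarrow> ('a \<Rightarrow>\<^sub>C 'b) \<Rightarrow> 'a \<Rightarrow>\<^sub>C 'b"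
  is "\<lambda>f g x. f x * g x"
proof -
  fix f g :: "'a \<Rightarrow> 'b"
  assume f: "f \<in> bcontfun" and g: "g \<in> bcontfun"
  obtain a where a: "\<And>x. norm (f x) \<le> a"
    using f by (auto simp: bcontfun_def bounded_iff)
  obtain b where b: "\<And>x. norm (g x) \<le> b"
    using g by (auto simp: bcontfun_def bounded_iff)
  show "(\<lambda>x. f x * g x) \<in> bcontfun"
  proof (rule bcontfun_normI)
    show "continuous_on UNIV (\<lambda>x. f x * g x)"
      using f g by (auto simp: bcontfun_def intro!: continuous_intros)
    show "norm (f x * g x) \<le> a * b" for x
      unfolding norm_mult
      by (rule mult_mono[OF a b order_trans[OF norm_ge_zero a] norm_ge_zero])
  qed
qed

lemmas [simp] = one_bcontfun.rep_eq times_bcontfun.rep_eq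

instance
proof
  show "(0 :: 'a \<Rightarrow>\<^sub>C 'b) \<noteq> 1"
    by (metis one_bcontfun.rep_eq zero_bcontfun.rep_eq zero_neq_one)
qed (auto intro!: bcontfun_eqI simp: algebra_simps)

end

lift_definition bcontfun_max ::
    "('a::topological_space \<Rightarrow>\<^sub>C real) \<Rightarrow> ('a \<Rightarrow>\<^sub>C real) \<Rightarrow> 'a \<Rightarrow>\<^sub>C real"
  is "\<lambda>f g x. max (f x) (g x)"
proof -
  fix f g :: "'a \<Rightarrow> real"
  assume f: "f \<in> bcontfun" and g: "g \<in> bcontfun"
  obtain a where a: "\<And>x. \<bar>f x\<bar> \<le> a"
    using f by (auto simp: bcontfun_def bounded_iff)
  obtain b where b: "\<And>x. \<bar>g x\<bar> \<le> b"
    using g by (auto simp: bcontfun_def bounded_iff)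
  show "(\<lambda>x. max (f x) (g x)) \<in> bcontfun"
  proof (rule bcontfun_normI)
    show "continuous_on UNIV (\<lambda>x. max (f x) (g x))"
      using f g by (auto simp: bcontfun_def intro!: continuous_intros)
    show "norm (max (f x) (g x)) \<le> max a b" for x
      using a[of x] b[of x] by (auto simp: max_def)
  qed
qed

definition bcontfun_min ::
    "('a::topological_space \<Rightarrow>\<^sub>C real) \<Rightarrow> ('a \<Rightarrow>\<^sub>C real) \<Rightarrow> 'a \<Rightarrow>\<^sub>C real"
  where "bcontfun_min f g = - bcontfun_max (- f) (- g)"

lemmas [simp] = bcontfun_max.rep_eq

lemma apply_bcontfun_min [simp]: "apply_bcontfun (bcontfun_min f g) x = min (f x) (g x)"
  by (simp add: bcontfun_min_def min_def max_def)

lifting_update bcontfun.lifting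
lifting_forget bcontfun.lifting

definition bcontfun_supp :: "('a::topological_space \<Rightarrow>\<^sub>C 'b::real_normed_vector) \<Rightarrow> 'a set"
  where "bcontfun_supp f = closure {x. apply_bcontfun f x \<noteq> 0}"

locale approximating_ring =
  fixes R :: "('x::polish_space \<Rightarrow>\<^sub>C real) set"
  assumes one_closed: "1 \<in> R"
    and uminus_closed: "f \<in> R \<Longrightarrow> - f \<in> R"
    and add_closed: "f \<in> R \<Longrightarrow> g \<in> R \<Longrightarrow> f + g \<in> R"
    and mult_closed: "f \<in> R \<Longrightarrow> g \<in> R \<Longrightarrow> f * g \<in> R"
    and max_closed: "f \<in> R \<Longrightarrow> g \<in> R \<Longrightarrow> bcontfun_max f g \<in> R"
    and min_closed: "f \<in> R \<Longrightarrow> g \<in> R \<Longrightarrow> bcontfun_min f g \<in> R"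
    and scaleR_closed: "f \<in> R \<Longrightarrow> c *\<^sub>R f \<in> R"
    and approximates_open:
      "open A \<Longrightarrow> \<exists>f :: nat \<Rightarrow> 'x \<Rightarrow>\<^sub>C real. range f \<subseteq> R \<and>
         (\<forall>x. incseq (\<lambda>k. f k x) \<and> (\<lambda>k. f k x) \<longlonglongrightarrow> indicator A x)"

text \<open>
  The action of \<open>R\<close> is only constrained on \<open>R\<close>. Its compatibility with the real scalars,
  \<open>smul (c *\<^sub>R 1) v = c *\<^sub>R v\<close>, is not a separate axiom: it follows from additivity and
  the case \<open>n = 1\<close> of the norm inequality.
\<close>

locale normed_module = approximating_ring R
  for R :: "('x::polish_space \<Rightarrow>\<^sub>C real) set" +
  fixes smul :: "('x \<Rightarrow>\<^sub>C real) \<Rightarrow> 'v::real_normed_vector \<Rightarrow> 'v"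
  assumes smul_add_right: "f \<in> R \<Longrightarrow> smul f (v + w) = smul f v + smul f w"
    and smul_add_left: "f \<in> R \<Longrightarrow> g \<in> R \<Longrightarrow> smul (f + g) v = smul f v + smul g v"
    and smul_mult: "f \<in> R \<Longrightarrow> g \<in> R \<Longrightarrow> smul (f * g) v = smul f (smul g v)"
    and smul_one: "smul 1 v = v"
    and norm_sum_smul_le:
      "\<And>(n::nat) f v. n \<ge> 1 \<Longrightarrow> (\<And>i. i < n \<Longrightarrow> f i \<in> R) \<Longrightarrow>
         disjoint_family_on (\<lambda>i. bcontfun_supp (f i)) {..<n} \<Longrightarrow>
         norm (\<Sum>i<n. smul (f i) (v i))
           \<le> (MAX i\<in>{..<n}. norm (f i)) * (MAX i\<in>{..<n}. norm (v i))"

definition local_seminorm ::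
    "('x::topological_space \<Rightarrow>\<^sub>C real) set \<Rightarrow> (('x \<Rightarrow>\<^sub>C real) \<Rightarrow> 'v::real_normed_vector \<Rightarrow> 'v)
       \<Rightarrow> 'x set \<Rightarrow> 'v \<Rightarrow> real"
  where "local_seminorm R smul A v =
    Sup {norm (smul f v) | f. f \<in> R \<and> bcontfun_supp f \<subseteq> A \<and> norm f \<le> 1}"

definition vector_measure :: "('x::topological_space set \<Rightarrow> 'b::real_normed_vector) \<Rightarrow> bool"
  where "vector_measure N \<longleftrightarrow>
    (\<forall>A :: nat \<Rightarrow> 'x set. range A \<subseteq> sets borel \<longrightarrow> disjoint_family A \<longrightarrow>
       (\<lambda>i. N (A i)) sums N (\<Union>i. A i))"

definition weakly_local ::
    "('x::topological_space \<Rightarrow>\<^sub>C real) set \<Rightarrow> (('x \<Rightarrow>\<^sub>C real) \<Rightarrow> 'v::real_normed_vector \<Rightarrow> 'v)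
       \<Rightarrow> ('x set \<Rightarrow> 'v \<Rightarrow>\<^sub>L real) \<Rightarrow> bool"
  where "weakly_local R smul N \<longleftrightarrow>
    (\<forall>A v. open A \<longrightarrow> local_seminorm R smul A v = 0 \<longrightarrow> blinfun_apply (N A) v = 0)"

definition local_vector_measure ::
    "('x::topological_space \<Rightarrow>\<^sub>C real) set \<Rightarrow> (('x \<Rightarrow>\<^sub>C real) \<Rightarrow> 'v::real_normed_vector \<Rightarrow> 'v)
       \<Rightarrow> ('x set \<Rightarrow> 'v \<Rightarrow>\<^sub>L real) \<Rightarrow> bool"
  where "local_vector_measure R smul N \<longleftrightarrow> vector_measure N \<and> weakly_local R smul N"

definition total_variation ::
    "('x::topological_space set \<Rightarrow> 'b::real_normed_vector) \<Rightarrow> 'x set \<Rightarrow> ennreal"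
  where "total_variation N E =
    (SUP P\<in>{P. finite P \<and> P \<subseteq> sets borel \<and> partition_on E P}. \<Sum>A\<in>P. ennreal (norm (N A)))"

end

theory Submission
  imports Defs
begin

text \<open>
  It suffices that \<open>\<parallel>N (A \<union> B)\<parallel> \<ge> \<parallel>N A\<parallel> + \<parallel>N B\<parallel>\<close> for disjoint Borel sets, for then the sum
  over every finite partition of \<open>E\<close> equals \<open>\<parallel>N E\<parallel>\<close>. Up to a set all of whose Borel subsets have
  small measure, some \<open>f \<in> R\<close> exceeds \<open>1\<close> on \<open>A\<close> and is below \<open>-1\<close> off \<open>A\<close>. Truncating \<open>f\<close>
  and \<open>- f\<close> gives \<open>g, h \<in> R\<close> with disjoint supports, equal to \<open>1\<close> on most of \<open>A\<close> and of \<open>B\<close>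
  respectively. If \<open>v\<close> and \<open>w\<close> almost realise \<open>\<parallel>N A\<parallel>\<close> and \<open>\<parallel>N B\<parallel>\<close> on the unit ball, then
  \<open>g v + h w\<close> lies in the unit ball by the module inequality, and by locality \<open>N (A \<union> B)\<close> takes
  on it almost the value \<open>N A v + N B w\<close>.
\<close>

section \<open>Vector measures\<close>

lemma vector_measure_empty:
  assumes "vector_measure N"
  shows "N {} = 0"
proof -
  have "(\<lambda>i::nat. N {}) sums N (\<Union>i::nat. {})"
    using assms unfolding vector_measure_def by (auto simp: disjoint_family_on_def)
  then have "(\<lambda>i::nat. N {}) \<longlonglongrightarrow> 0"
    by (meson sums_summable summable_LIMSEQ_zero)
  then show ?thesis
    by (simp add: LIMSEQ_const_iff)
qed

lemma vector_measure_Un: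
  assumes "vector_measure N" "A \<in> sets borel" "B \<in> sets borel" "A \<inter> B = {}"
  shows "N (A \<union> B) = N A + N B"
proof -
  have "disjoint_family (binaryset A B)" "range (binaryset A B) \<subseteq> sets borel"
    using assms by (auto simp: disjoint_family_on_def binaryset_def)
  then have "(\<lambda>i. N (binaryset A B i)) sums N (A \<union> B)"
    using assms(1) unfolding vector_measure_def by (metis UN_binaryset_eq)
  then show ?thesis
    using binaryset_sums[of N A B] vector_measure_empty[OF assms(1)] sums_unique2 by blast
qed

lemma vector_measure_split:
  assumes "vector_measure N" "A \<in> sets borel" "B \<in> sets borel"
  shows "N A = N (A \<inter> B) + N (A - B)"
  using vector_measure_Un[OF assms(1), of "A \<inter> B" "A - B"] assms
  by (metis Diff_disjoint Int_Diff_Un Int_Diff_disjoint sets.Diff sets.Int)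

text \<open>The partial sums of \<open>N\<close> over the disjointed sequence telescope to
  \<open>N (A n)\<close>, so continuity from below is \<sigma>-additivity.\<close>

lemma vector_measure_incseq:
  assumes N: "vector_measure N" and A: "range A \<subseteq> sets borel" "incseq A"
  shows "(\<lambda>n. N (A n)) \<longlonglongrightarrow> N (\<Union>n. A n)"
proof -
  have m: "A n \<in> sets borel" for n
    using A by auto
  have "(\<Sum>i\<le>n. N (disjointed A i)) = N (A n)" for n
  proof (induction n)
    case (Suc n)
    have "A (Suc n) \<inter> A n = A n"
      using A(2) by (auto simp: incseq_Suc_iff)
    then show ?case
      using Suc vector_measure_split[OF N m m, of "Suc n" n] disjointed_mono[OF A(2)] by simp
  qed simp
  moreover have "(\<lambda>i. N (disjointed A i)) sums N (\<Union>i. disjointed A i)"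
    using N sets.range_disjointed_sets[OF A(1)] disjoint_family_disjointed[of A]
    unfolding vector_measure_def by blast
  ultimately show ?thesis
    by (simp add: sums_def_le UN_disjointed_eq)
qed

section \<open>Sets of small semivariation\<close>

text \<open>The supremum of \<open>norm (N B)\<close> over Borel \<open>B \<subseteq> S\<close> is
  comparable to the semivariation. Unlike the total variation it can be controlled before any
  finiteness is known.\<close>

definition small_on ::
    "('x::topological_space set \<Rightarrow> 'b::real_normed_vector) \<Rightarrow> real \<Rightarrow> 'x set \<Rightarrow> bool"
  where "small_on N e S \<longleftrightarrow> (\<forall>B\<in>sets borel. B \<subseteq> S \<longrightarrow> norm (N B) \<le> e)"

lemma small_on_subset: "small_on N e S \<Longrightarrow> T \<subseteq> S \<Longrightarrow> small_on N e T"
  unfolding small_on_def by blast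

lemma small_on_Un:
  assumes "vector_measure N" "small_on N d S" "small_on N e T" "S \<in> sets borel"
  shows "small_on N (d + e) (S \<union> T)"
  unfolding small_on_def
proof (intro ballI impI)
  fix B :: "'a set"
  assume B: "B \<in> sets borel" "B \<subseteq> S \<union> T"
  then have "norm (N (B \<inter> S)) \<le> d" "norm (N (B - S)) \<le> e"
    using assms(2-4) unfolding small_on_def by (blast intro: sets.Int sets.Diff)+
  then show "norm (N B) \<le> d + e"
    using vector_measure_split[OF assms(1) B(1) assms(4)]
    by (metis add_mono norm_triangle_ineq order_trans)
qed

text \<open>A Borel subset of the union is cut along the disjointed sequence; each piece still lies
  in \<open>S i\<close>, so the bounds \<open>e i\<close> add up.\<close>

lemma small_on_UN:
  assumes N: "vector_measure N" and S: "\<And>i::nat. S i \<in> sets borel"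
    and small: "\<And>i. small_on N (e i) (S i)" and e: "e sums c"
  shows "small_on N c (\<Union>i. S i)"
  unfolding small_on_def
proof (intro ballI impI)
  fix B :: "'a set"
  assume B: "B \<in> sets borel" "B \<subseteq> (\<Union>i. S i)"
  define D where "D i = B \<inter> disjointed S i" for i
  have "range (disjointed S) \<subseteq> sets borel"
    using S by (intro sets.range_disjointed_sets) auto
  then have D: "D i \<in> sets borel" for i
    using B(1) unfolding D_def by auto
  have "disjoint_family D"
    using disjoint_family_disjointed[of S] unfolding D_def disjoint_family_on_def by blast
  moreover have UN: "(\<Union>i. D i) = B"
    using B(2) UN_disjointed_eq[of S] unfolding D_def by blast
  ultimately have sums: "(\<lambda>i. N (D i)) sums N B"
    using N D unfolding vector_measure_def by (metis image_subsetI)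
  have le: "norm (N (D i)) \<le> e i" for i
    using small[of i] D[of i] disjointed_subset[of S i] unfolding small_on_def D_def by blast
  have "norm (\<Sum>i<n. N (D i)) \<le> (\<Sum>i<n. e i)" for n
    by (rule order_trans[OF norm_sum sum_mono[OF le]])
  then show "norm (N B) \<le> c"
    using sums e unfolding sums_def by (intro LIMSEQ_le[OF tendsto_norm]) auto
qed

text \<open>
  Otherwise one could pick disjoint sets \<open>B \<subseteq> A n - A m\<close> with \<open>\<parallel>N B\<parallel> > e\<close> over and over,
  contradicting the convergence of \<open>N\<close> along disjoint sequences.
\<close>
lemma small_on_decseq:
  assumes N: "vector_measure N" and A: "range A \<subseteq> sets borel" "decseq A" "(\<Inter>n. A n) = {}"
    and e: "e > 0"
  obtains n where "small_on N e (A n)"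
proof (rule ccontr)
  assume "\<not> thesis"
  with that have "\<forall>n. \<exists>B. B \<in> sets borel \<and> B \<subseteq> A n \<and> norm (N B) > e"
    unfolding small_on_def by (meson not_le)
  then obtain B where B: "\<And>n. B n \<in> sets borel" "\<And>n. B n \<subseteq> A n" "\<And>n. norm (N (B n)) > e"
    by metis
  have mA: "A n \<in> sets borel" for n
    using A by auto
  \<comment> \<open>The sets \<open>B n - A m\<close> increase to \<open>B n\<close> because the
    \<open>A m\<close> shrink to the empty set; the strict bound on \<open>N (B n)\<close> therefore
    survives for large \<open>m\<close>.\<close>
  have "\<exists>m>n. norm (N (B n - A m)) > e" for n
  proof -
    have "(\<lambda>m. N (B n - A m)) \<longlonglongrightarrow> N (\<Union>m. B n - A m)"
      using B mA decseqD[OF A(2)] by (intro vector_measure_incseq[OF N]) (auto intro!: monoI, blast)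
    moreover have "(\<Union>m. B n - A m) = B n"
      using A(3) by blast
    ultimately have "(\<lambda>m. norm (N (B n - A m))) \<longlonglongrightarrow> norm (N (B n))"
      by (simp add: tendsto_norm)
    then have "\<forall>\<^sub>F m in sequentially. norm (N (B n - A m)) > e"
      using B(3) by (rule order_tendstoD)
    then have "\<forall>\<^sub>F m in sequentially. norm (N (B n - A m)) > e \<and> m > n"
      by (intro eventually_conj eventually_gt_at_top)
    then show ?thesis
      using eventually_happens'[OF sequentially_bot] by blast
  qed
  then obtain s where s: "\<And>n. s n > n" "\<And>n. norm (N (B n - A (s n))) > e"
    by metis
  \<comment> \<open>Iterating \<open>s\<close> places the sets \<open>C n\<close> in the successive
    differences \<open>A (k n) - A (k (Suc n))\<close>, which makes them disjoint.\<close>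
  define k where "k n = (s ^^ n) 0" for n
  have k: "k (Suc n) = s (k n)" for n
    by (simp add: k_def)
  have "incseq k"
    using s(1) k by (simp add: incseq_Suc_iff less_imp_le)
  define C where "C n = B (k n) - A (k (Suc n))" for n
  have disj: "C m \<inter> C n = {}" if "m < n" for m n
  proof -
    have "k (Suc m) \<le> k n"
      using \<open>incseq k\<close> that by (simp add: incseqD Suc_leI)
    then have "A (k n) \<subseteq> A (k (Suc m))"
      by (rule decseqD[OF A(2)])
    then show ?thesis
      using B(2)[of "k n"] unfolding C_def by blast
  qed
  then have "disjoint_family C"
    unfolding disjoint_family_on_def by (metis Int_commute linorder_neqE_nat)
  then have "(\<lambda>n. N (C n)) sums N (\<Union>n. C n)"
    using N B(1) mA unfolding vector_measure_def C_def by (simp add: image_subset_iff)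
  then have "(\<lambda>n. N (C n)) \<longlonglongrightarrow> 0"
    by (meson sums_summable summable_LIMSEQ_zero)
  then have "(\<lambda>n. norm (N (C n))) \<longlonglongrightarrow> 0"
    by (rule tendsto_norm_zero)
  then have "\<forall>\<^sub>F n in sequentially. norm (N (C n)) < e"
    using e by (rule order_tendstoD)
  then obtain n where "norm (N (C n)) < e"
    by (meson eventually_happens' sequentially_bot)
  then show False
    using s(2)[of "k n"] by (simp add: C_def k)
qed

section \<open>Separating Borel sets from their complements\<close>

context approximating_ring
begin

lemma zero_closed: "0 \<in> R"
  using scaleR_closed[OF one_closed, of 0] by simp

text \<open>The thresholds are symmetric so that passing to the complement of \<open>A\<close>
  corresponds to passing to \<open>- f\<close>. The gap between them leaves room for two cutoffs
  with disjoint supports.\<close>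

definition separation_defect :: "('x \<Rightarrow>\<^sub>C real) \<Rightarrow> 'x set \<Rightarrow> 'x set"
  where "separation_defect f A = {x \<in> A. f x \<le> 1} \<union> {x. x \<notin> A \<and> f x \<ge> -1}"

lemma borel_measurable_bcontfun [measurable]: "apply_bcontfun f \<in> borel_measurable borel"
  for f :: "'x \<Rightarrow>\<^sub>C real"
  by (intro borel_measurable_continuous_onI continuous_on_apply_bcontfun)

lemma separation_defect_borel [measurable]:
  assumes [measurable]: "A \<in> sets borel"
  shows "separation_defect f A \<in> sets borel"
  unfolding separation_defect_def by measurable

text \<open>Induction along the generation of the Borel sets by the open ones: open sets are served
  by \<open>approximates_open\<close>, complements by \<open>- f\<close>, and countable unions by a
  maximum of finitely many functions, the remaining sets contributing little.\<close>

lemma ex_separation_defect_small: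
  assumes N: "vector_measure N" and A: "A \<in> sets borel" and e: "e > 0"
  shows "\<exists>f\<in>R. small_on N e (separation_defect f A)"
proof -
  have "A \<in> sigma_sets UNIV {S. open S}"
    using A by (simp add: borel_def)
  then show ?thesis
    using e
  proof (induction arbitrary: e)
    case (Basic A)
    then have "open A"
      by simp
    then have [measurable]: "A \<in> sets borel"
      by simp
    from approximates_open[OF \<open>open A\<close>] obtain f where f: "range f \<subseteq> R"
        "\<And>x. incseq (\<lambda>k. f k x)" "\<And>x. (\<lambda>k. f k x) \<longlonglongrightarrow> indicator A x"
      by blast
    define S where "S k = {x \<in> A. f k x \<le> 3/4}" for k
    have "(\<Inter>k. S k) = {}"
    proof -
      have "x \<notin> (\<Inter>k. S k)" if "x \<in> A" for x
      proof -
        have "\<forall>\<^sub>F k in sequentially. f k x > 3/4"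
          using f(3)[of x] that by (intro order_tendstoD) auto
        then obtain k where "f k x > 3/4"
          by (meson eventually_happens' sequentially_bot)
        then show ?thesis
          by (auto simp: S_def not_le)
      qed
      then show ?thesis
        unfolding S_def by blast
    qed
    moreover have "decseq S"
    proof (rule decseq_SucI)
      fix n
      have "f n x \<le> f (Suc n) x" for x
        using f(2)[of x] by (rule incseq_SucD)
      then show "S (Suc n) \<le> S n"
        unfolding S_def by (blast intro: order_trans)
    qed
    moreover have "range S \<subseteq> sets borel"
      unfolding S_def by auto
    ultimately obtain k where k: "small_on N e (S k)"
      using small_on_decseq[OF N] \<open>e > 0\<close> by metis
    \<comment> \<open>The affine map sends 3/4 to 1 and 0 to -2, so the defect of \<open>g\<close>
      can only come from \<open>S k\<close>.\<close>
    define g where "g = 4 *\<^sub>R f k + (- 2) *\<^sub>R 1"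
    have g: "g x = 4 * f k x - 2" for x
      by (simp add: g_def)
    have "g \<in> R"
      using f(1) unfolding g_def by (intro add_closed scaleR_closed one_closed) auto
    moreover have "f k x \<le> 0" if "x \<notin> A" for x
      using incseq_le[OF f(2)[of x] f(3)[of x], of k] that by simp
    then have "separation_defect g A \<subseteq> S k"
      unfolding separation_defect_def S_def g by force
    ultimately show ?case
      using k small_on_subset by blast
  next
    case Empty
    have "small_on N e (separation_defect ((- 2) *\<^sub>R 1) {})"
      using Empty vector_measure_empty[OF N] by (simp add: separation_defect_def small_on_def)
    then show ?case
      using scaleR_closed one_closed by blast
  next
    case (Compl A)
    then obtain f where f: "f \<in> R" "small_on N e (separation_defect f A)"
      by blast
    have "separation_defect (- f) (UNIV - A) = separation_defect f A"
      unfolding separation_defect_def by auto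
    then show ?case
      using f uminus_closed by metis
  next
    case (Union A)
    have A [measurable]: "A i \<in> sets borel" for i
      using Union.hyps by (simp add: borel_def)
    \<comment> \<open>The individual defects sum to \<open>e / 2\<close>; the other half is reserved
      for the tail \<open>S n\<close> of the union.\<close>
    have "\<exists>f\<in>R. small_on N (e / 2 * (1/2) ^ Suc i) (separation_defect f (A i))" for i
      using Union.prems by (intro Union.IH) auto
    then obtain f where f: "\<And>i. f i \<in> R"
        "\<And>i. small_on N (e / 2 * (1/2) ^ Suc i) (separation_defect (f i) (A i))"
      by metis
    define D where "D = (\<Union>i. separation_defect (f i) (A i))"
    have "(\<lambda>i. e / 2 * (1/2) ^ Suc i) sums (e / 2)"
      using sums_mult[OF power_half_series, of "e / 2"] by simp
    then have D: "small_on N (e / 2) D"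
      unfolding D_def by (intro small_on_UN[OF N _ f(2)]) auto
    define S where "S n = (\<Union>i. A i) - (\<Union>i\<le>n. A i)" for n
    have "decseq S"
      unfolding S_def by (intro decseq_SucI) force
    moreover have "(\<Inter>n. S n) = {}"
      unfolding S_def by blast
    moreover have "range S \<subseteq> sets borel"
      unfolding S_def by auto
    ultimately obtain n where n: "small_on N (e / 2) (S n)"
      using small_on_decseq[OF N, of S "e / 2"] \<open>e > 0\<close> by auto
    define g where "g = rec_nat (f 0) (\<lambda>i h. bcontfun_max h (f (Suc i)))"
    have g: "g m \<in> R" for m
      by (induction m) (simp_all add: g_def f(1) max_closed)
    have ge: "f i x \<le> g m x" if "i \<le> m" for i m x
      using that by (induction m) (auto simp: g_def le_Suc_eq le_max_iff_disj)
    have attained: "\<exists>i\<le>m. g m x = f i x" for m x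
    proof (induction m)
      case (Suc m)
      then show ?case
        by (cases "g m x \<le> f (Suc m) x") (auto simp: g_def max_def le_Suc_eq)
    qed (simp add: g_def)
    \<comment> \<open>\<open>g n\<close> is the maximum of \<open>f 0\<close>, ...,
      \<open>f n\<close>. In the union but outside \<open>S n\<close>, some \<open>f i\<close> with
      \<open>x \<in> A i\<close> is bounded by \<open>g n x \<le> 1\<close>; outside the union, the
      \<open>f i\<close> attaining the maximum is at least -1. Either way \<open>x\<close> is in the
      defect of that \<open>f i\<close>.\<close>
    have "separation_defect (g n) (\<Union>i. A i) \<subseteq> D \<union> S n"
    proof
      fix x
      assume x: "x \<in> separation_defect (g n) (\<Union>i. A i)"
      show "x \<in> D \<union> S n"
      proof (cases "x \<in> (\<Union>i. A i)")
        case True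
        show ?thesis
        proof (cases "x \<in> S n")
          case False
          with True obtain i where i: "i \<le> n" "x \<in> A i"
            unfolding S_def by blast
          then have "f i x \<le> 1"
            using ge[OF i(1), of x] x unfolding separation_defect_def by auto
          then show ?thesis
            using i unfolding D_def separation_defect_def by blast
        qed simp
      next
        case False
        obtain i where "g n x = f i x"
          using attained by blast
        then show ?thesis
          using False x unfolding D_def separation_defect_def by auto
      qed
    qed
    moreover have "D \<in> sets borel"
      unfolding D_def by auto
    ultimately have "small_on N e (separation_defect (g n) (\<Union>i. A i))"
      using small_on_Un[OF N D n] small_on_subset by force
    then show ?case
      using g by blast
  qed
qed

text \<open>The ramp starts at 1/2 rather than 0, so that even the closed supports of
  \<open>cutoff f\<close> and \<open>cutoff (- f)\<close> are disjoint.\<close>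

definition cutoff :: "('x \<Rightarrow>\<^sub>C real) \<Rightarrow> 'x \<Rightarrow>\<^sub>C real"
  where "cutoff f = bcontfun_min 1 (bcontfun_max 0 (2 *\<^sub>R f - 1))"

lemma cutoff_apply: "cutoff f x = min 1 (max 0 (2 * f x - 1))"
  by (simp add: cutoff_def)

lemma cutoff_closed: "f \<in> R \<Longrightarrow> cutoff f \<in> R"
  unfolding cutoff_def diff_conv_add_uminus
  by (intro min_closed max_closed add_closed uminus_closed scaleR_closed one_closed zero_closed)

lemma norm_cutoff_le: "norm (cutoff f) \<le> 1"
  by (rule norm_bound) (auto simp: cutoff_apply)

lemma supp_cutoff: "bcontfun_supp (cutoff f) \<subseteq> {x. f x \<ge> 1/2}"
  unfolding bcontfun_supp_def
proof (rule closure_minimal)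
  show "{x. cutoff f x \<noteq> 0} \<subseteq> {x. f x \<ge> 1/2}"
    by (auto simp: cutoff_apply min_def max_def)
  show "closed {x. f x \<ge> 1/2}"
    by (intro closed_Collect_le continuous_intros continuous_on_apply_bcontfun)
qed

end

section \<open>Locality on Borel sets\<close>

lemma local_seminorm_eq_0:
  assumes "\<And>f. f \<in> R \<Longrightarrow> bcontfun_supp f \<subseteq> A \<Longrightarrow> smul f v = 0" and "0 \<in> R"
  shows "local_seminorm R smul A v = 0"
proof -
  \<comment> \<open>\<open>0 \<in> R\<close> keeps the set nonempty, so that its real
    \<open>Sup\<close> has the intended value.\<close>
  have "{norm (smul f v) | f. f \<in> R \<and> bcontfun_supp f \<subseteq> A \<and> norm f \<le> 1} = {0}"
    using assms by (force simp: bcontfun_supp_def intro!: exI[of _ 0])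
  then show ?thesis
    by (simp add: local_seminorm_def)
qed

text \<open>Weak locality speaks of open sets only. These form an intersection-stable generator, and
  the sets \<open>B\<close> for which \<open>N (B \<inter> W)\<close> annihilates \<open>v\<close>
  are closed under complements and countable disjoint unions.\<close>

lemma local_vector_measure_vanishes:
  assumes "local_vector_measure R smul N" and "open W" and "B \<in> sets borel" "B \<subseteq> W"
    and zero: "\<And>f. f \<in> R \<Longrightarrow> bcontfun_supp f \<subseteq> W \<Longrightarrow> smul f v = 0" and "0 \<in> R"
  shows "blinfun_apply (N B) v = 0"
proof -
  have N: "vector_measure N" and loc: "weakly_local R smul N"
    using assms(1) by (auto simp: local_vector_measure_def)
  have op: "blinfun_apply (N U) v = 0" if "open U" "U \<subseteq> W" for U
    using loc that local_seminorm_eq_0[of R U smul v] zero \<open>0 \<in> R\<close>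
    unfolding weakly_local_def by blast
  have W: "W \<in> sets borel"
    using \<open>open W\<close> by simp
  have "Int_stable {S::'a set. open S}" "{S::'a set. open S} \<subseteq> Pow UNIV"
    by (auto simp: Int_stable_def)
  moreover have "B \<in> sigma_sets UNIV {S. open S}"
    using assms by (simp add: borel_def)
  ultimately have "blinfun_apply (N (B \<inter> W)) v = 0"
  proof (induction rule: sigma_sets_induct_disjoint)
    case (basic A)
    then show ?case
      using \<open>open W\<close> by (intro op) auto
  next
    case empty
    then show ?case
      using vector_measure_empty[OF N] by simp
  next
    case (compl A)
    then have "N W = N (A \<inter> W) + N ((UNIV - A) \<inter> W)"
      using vector_measure_split[OF N W, of A]
      by (simp add: borel_def Int_commute Diff_eq)
    then show ?case
      using compl op[OF \<open>open W\<close>] by (simp add: blinfun.add_left)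
  next
    case (union A)
    have "disjoint_family (\<lambda>i. A i \<inter> W)"
      using union(1) unfolding disjoint_family_on_def by blast
    moreover have "range A \<subseteq> sets borel"
      using union(2) by (simp add: borel_def)
    then have "range (\<lambda>i. A i \<inter> W) \<subseteq> sets borel"
      using W by auto
    ultimately have "(\<lambda>i. N (A i \<inter> W)) sums N (\<Union>i. A i \<inter> W)"
      using N unfolding vector_measure_def by blast
    then have "(\<lambda>i. blinfun_apply (N (A i \<inter> W)) v) sums blinfun_apply (N (\<Union>i. A i \<inter> W)) v"
      by (rule bounded_linear.sums[OF blinfun.bounded_linear_left])
    then show ?case
      using union(3) by (simp add: sums_iff)
  qed
  then show ?thesis
    using \<open>B \<subseteq> W\<close> by (simp add: Int_absorb2)
qed

section \<open>Additivity of the norm\<close>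

lemma blinfun_norm_almost_attained:
  fixes L :: "'v::real_normed_vector \<Rightarrow>\<^sub>L real"
  assumes "e > 0"
  obtains v where "norm v \<le> 1" "blinfun_apply L v > norm L - e"
\<comment> \<open>A bound for the operator norm has to be nonnegative; when
  \<open>norm L - e\<close> is negative, \<open>v = 0\<close> already works.\<close>
proof (cases "norm L < e")
  case True
  then show ?thesis
    using that[of 0] by simp
next
  case False
  then have "\<exists>x. \<bar>blinfun_apply L x\<bar> > (norm L - e) * norm x"
    using norm_blinfun_bound[of "norm L - e" L] assms by (force simp: not_le[symmetric])
  then obtain x where x: "\<bar>blinfun_apply L x\<bar> > (norm L - e) * norm x"
    by blast
  then have "x \<noteq> 0"
    by auto
  define v where "v = (sgn (blinfun_apply L x) / norm x) *\<^sub>R x"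
  have "norm v \<le> 1"
    using \<open>x \<noteq> 0\<close> by (simp add: v_def sgn_real_def)
  moreover have "blinfun_apply L v = \<bar>blinfun_apply L x\<bar> / norm x"
    by (simp add: v_def blinfun.scaleR_right sgn_real_def)
  then have "blinfun_apply L v > norm L - e"
    using x \<open>x \<noteq> 0\<close> by (simp add: pos_less_divide_eq)
  ultimately show ?thesis
    using that by blast
qed

context normed_module
begin

lemma smul_zero_left: "smul 0 v = 0"
  using smul_add_left[OF zero_closed zero_closed, of v] by simp

lemma smul_diff_right: "f \<in> R \<Longrightarrow> smul f (v - w) = smul f v - smul f w"
  using smul_add_right[of f "v - w" w] by simp

text \<open>The module inequality for two summands; it keeps the glued test vector in the unit
  ball.\<close>

lemma norm_smul_add_smul_le:
  assumes "f \<in> R" "g \<in> R" "bcontfun_supp f \<inter> bcontfun_supp g = {}"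
    and "norm f \<le> 1" "norm g \<le> 1" "norm v \<le> 1" "norm w \<le> 1"
  shows "norm (smul f v + smul g w) \<le> 1"
proof -
  define F where "F i = (if i = 0 then f else g)" for i :: nat
  define V where "V i = (if i = 0 then v else w)" for i :: nat
  have two: "{..<2::nat} = {0, 1}"
    by auto
  have "disjoint_family_on (\<lambda>i. bcontfun_supp (F i)) {..<2}"
    using assms(3) unfolding two F_def disjoint_family_on_def by auto
  then have "norm (\<Sum>i<2. smul (F i) (V i))
      \<le> (MAX i\<in>{..<2}. norm (F i)) * (MAX i\<in>{..<2}. norm (V i))"
    using assms(1,2) by (intro norm_sum_smul_le) (auto simp: F_def)
  also have "\<dots> = max (norm f) (norm g) * max (norm v) (norm w)"
    by (simp add: two F_def V_def)
  also have "\<dots> \<le> 1 * 1"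
    using assms(4-7) by (intro mult_mono) (auto simp: le_max_iff_disj)
  finally show ?thesis
    by (simp add: two F_def V_def)
qed

text \<open>For \<open>f\<close> supported in \<open>W\<close>, \<open>f * g = f\<close> and
  \<open>f * h = 0\<close>, so \<open>f\<close> annihilates the difference of the two vectors and
  locality applies.\<close>

lemma local_vector_measure_eqI:
  assumes N: "local_vector_measure R smul N" and gh: "g \<in> R" "h \<in> R"
    and W: "open W" "\<And>x. x \<in> W \<Longrightarrow> g x = 1" "\<And>x. x \<in> W \<Longrightarrow> h x = 0"
    and B: "B \<in> sets borel" "B \<subseteq> W"
  shows "blinfun_apply (N B) (smul g v + smul h w) = blinfun_apply (N B) v"
proof -
  have "smul f (smul g v + smul h w - v) = 0" if f: "f \<in> R" "bcontfun_supp f \<subseteq> W" for f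
  proof -
    have "f x = 0" if "x \<notin> W" for x
      using f(2) that closure_subset[of "{x. f x \<noteq> 0}"] unfolding bcontfun_supp_def by blast
    then have "f x * g x = f x" "f x * h x = 0" for x
      using W(2,3) by (cases "x \<in> W"; simp)+
    then have "f * g = f" "f * h = 0"
      by (auto intro!: bcontfun_eqI)
    then have "smul f (smul g v) = smul f v" "smul f (smul h w) = 0"
      using smul_mult[OF f(1) gh(1), of v] smul_mult[OF f(1) gh(2), of w]
      by (simp_all add: smul_zero_left)
    then show ?thesis
      using f(1) by (simp add: smul_diff_right smul_add_right)
  qed
  then have "blinfun_apply (N B) (smul g v + smul h w - v) = 0"
    using local_vector_measure_vanishes[OF N W(1) B _ zero_closed] by blast
  then show ?thesis
    by (simp add: blinfun.diff_right)
qed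

lemma norm_local_vector_measure_Un_ge:
  assumes loc: "local_vector_measure R smul N"
    and A [measurable]: "A \<in> sets borel" and B [measurable]: "B \<in> sets borel"
    and disj: "A \<inter> B = {}"
  shows "norm (N A) + norm (N B) \<le> norm (N (A \<union> B))"
proof (rule field_le_epsilon)
  fix d :: real
  assume "d > 0"
  \<comment> \<open>Six errors occur: two from almost attaining the norms, four from evaluating
    \<open>N (A - U)\<close> at \<open>v\<close> and \<open>u\<close> and \<open>N (B - W)\<close>
    at \<open>w\<close> and \<open>u\<close>.\<close>
  define e where "e = d / 6"
  have e: "e > 0"
    using \<open>d > 0\<close> by (simp add: e_def)
  have N: "vector_measure N"
    using loc by (simp add: local_vector_measure_def)
  obtain f where f: "f \<in> R" "small_on N e (separation_defect f A)"
    using ex_separation_defect_small[OF N A e] by blast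
  obtain v where v: "norm v \<le> 1" "blinfun_apply (N A) v > norm (N A) - e"
    using blinfun_norm_almost_attained[OF e] by blast
  obtain w where w: "norm w \<le> 1" "blinfun_apply (N B) w > norm (N B) - e"
    using blinfun_norm_almost_attained[OF e] by blast
  define g where "g = cutoff f"
  define h where "h = cutoff (- f)"
  define u where "u = smul g v + smul h w"
  have gh: "g \<in> R" "h \<in> R"
    using f(1) by (auto simp: g_def h_def intro: cutoff_closed uminus_closed)
  have "bcontfun_supp g \<inter> bcontfun_supp h = {}"
    using supp_cutoff[of f] supp_cutoff[of "- f"] unfolding g_def h_def by force
  then have u: "norm u \<le> 1"
    using gh v(1) w(1) norm_cutoff_le unfolding u_def g_def h_def
    by (intro norm_smul_add_smul_le) auto
  \<comment> \<open>On the open set \<open>U\<close>, \<open>g = 1\<close> and \<open>h = 0\<close>;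
    on \<open>W\<close> it is the other way round. What \<open>A\<close> and \<open>B\<close> lose
    outside \<open>U\<close> and \<open>W\<close> lies in the defect.\<close>
  define U where "U = {x. f x > 1}"
  define W where "W = {x. f x < -1}"
  have "open U" "open W"
    unfolding U_def W_def
    by (intro open_Collect_less continuous_intros continuous_on_apply_bcontfun)+
  then have [measurable]: "U \<in> sets borel" "W \<in> sets borel"
    by simp_all
  have small: "\<bar>blinfun_apply (N S) z\<bar> \<le> e"
    if "S \<in> sets borel" "S \<subseteq> separation_defect f A" "norm z \<le> 1" for S z
  proof -
    have "\<bar>blinfun_apply (N S) z\<bar> \<le> norm (N S) * norm z"
      using norm_blinfun[of "N S" z] by simp
    also have "\<dots> \<le> e * 1"
      using f(2) that e unfolding small_on_def by (intro mult_mono) auto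
    finally show ?thesis
      by simp
  qed
  have 1: "blinfun_apply (N (A \<inter> U)) u = blinfun_apply (N (A \<inter> U)) v"
    unfolding u_def
    by (rule local_vector_measure_eqI[OF loc gh \<open>open U\<close>]) (auto simp: g_def h_def U_def cutoff_apply)
  have 2: "blinfun_apply (N (B \<inter> W)) u = blinfun_apply (N (B \<inter> W)) w"
    unfolding u_def add.commute[of "smul g v"]
    by (rule local_vector_measure_eqI[OF loc gh(2,1) \<open>open W\<close>])
      (auto simp: g_def h_def W_def cutoff_apply)
  have NA: "N A = N (A \<inter> U) + N (A - U)" and NB: "N B = N (B \<inter> W) + N (B - W)"
    by (intro vector_measure_split[OF N]; measurable)+
  have "N (A \<union> B) = N A + N B"
    by (intro vector_measure_Un[OF N A B disj])
  then have "blinfun_apply (N (A \<union> B)) u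
      = blinfun_apply (N A) v - blinfun_apply (N (A - U)) v + blinfun_apply (N (A - U)) u
        + (blinfun_apply (N B) w - blinfun_apply (N (B - W)) w + blinfun_apply (N (B - W)) u)"
    by (simp add: NA NB blinfun.add_left 1 2)
  moreover have "A - U \<subseteq> separation_defect f A" "B - W \<subseteq> separation_defect f A"
    using disj unfolding U_def W_def separation_defect_def by auto
  then have "\<bar>blinfun_apply (N (A - U)) z\<bar> \<le> e" "\<bar>blinfun_apply (N (B - W)) z\<bar> \<le> e"
    if "norm z \<le> 1" for z
    using that by (auto intro!: small)
  note this[OF v(1)] this[OF w(1)] this[OF u]
  moreover have "blinfun_apply (N (A \<union> B)) u \<le> norm (N (A \<union> B)) * norm u"
    using norm_blinfun[of "N (A \<union> B)" u] by simp
  then have "blinfun_apply (N (A \<union> B)) u \<le> norm (N (A \<union> B))"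
    using u mult_left_le[of "norm u" "norm (N (A \<union> B))"] by simp
  ultimately show "norm (N A) + norm (N B) \<le> norm (N (A \<union> B)) + d"
    using v(2) w(2) by (simp add: e_def abs_le_iff)
qed

lemma norm_local_vector_measure_Un:
  assumes "local_vector_measure R smul N" "A \<in> sets borel" "B \<in> sets borel" "A \<inter> B = {}"
  shows "norm (N (A \<union> B)) = norm (N A) + norm (N B)"
  using norm_local_vector_measure_Un_ge[OF assms] vector_measure_Un[of N A B] assms
    norm_triangle_ineq[of "N A" "N B"]
  by (auto simp: local_vector_measure_def)

lemma sum_norm_local_vector_measure:
  assumes N: "local_vector_measure R smul N"
    and P: "finite P" "P \<subseteq> sets borel" "disjoint P"
  shows "(\<Sum>A\<in>P. norm (N A)) = norm (N (\<Union>P))"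
  using P
proof (induction rule: finite_induct)
  case empty
  then show ?case
    using N vector_measure_empty[of N] by (simp add: local_vector_measure_def)
next
  case (insert A P)
  have "A \<inter> \<Union>P = {}"
    using insert.prems(2) insert.hyps(2) by (auto dest: disjointD)
  moreover have "\<Union>P \<in> sets borel"
    using insert.hyps(1) insert.prems(1) by (intro sets.finite_Union) auto
  ultimately have "norm (N (A \<union> \<Union>P)) = norm (N A) + norm (N (\<Union>P))"
    using insert.prems(1) by (intro norm_local_vector_measure_Un[OF N]) auto
  then show ?case
    using insert.IH insert.prems insert.hyps by (simp add: pairwise_insert)
qed

lemma total_variation_local_vector_measure:
  assumes N: "local_vector_measure R smul N" and E: "E \<in> sets borel"
  shows "total_variation N E = ennreal (norm (N E))"
proof -
  let ?Q = "{P. finite P \<and> P \<subseteq> sets borel \<and> partition_on E P}"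
  have "(\<Sum>A\<in>P. ennreal (norm (N A))) = ennreal (norm (N E))" if "P \<in> ?Q" for P
    using that sum_norm_local_vector_measure[OF N, of P]
    by (simp add: partition_on_def sum_ennreal)
  \<comment> \<open>The supremum of a constant needs a nonempty index set; blocks of a partition are
    nonempty, hence the separate value for \<open>E = {}\<close>.\<close>
  moreover have "(if E = {} then {} else {E}) \<in> ?Q"
    using E by (auto simp: partition_on_def disjoint_def)
  then have "?Q \<noteq> {}"
    by blast
  ultimately show ?thesis
    unfolding total_variation_def by simp
qed

end

theorem proposition1p14:
  fixes R :: "('x::polish_space \<Rightarrow>\<^sub>C real) set"
    and smul :: "('x \<Rightarrow>\<^sub>C real) \<Rightarrow> 'v::real_normed_vector \<Rightarrow> 'v"
    and N :: "'x set \<Rightarrow> 'v \<Rightarrow>\<^sub>L real"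
  assumes "normed_module R smul"
    and "local_vector_measure R smul N"
  shows "total_variation N UNIV < \<infinity> \<and>
    (\<forall>A\<in>sets borel. total_variation N A = ennreal (norm (N A)))"
  using normed_module.total_variation_local_vector_measure[OF assms] by simp

end
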